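(* Let $\mathcal{G}=(\mathcal{V},\mathcal{E})$ be a directed graph with $\mathcal{V}=\{1,\ldots,N\}$ and a self loop at every node, and let $A\in\mathbb{T}^{N\times N}$ be its tropical adjacency matrix. Then the max-consensus protocol $$x_i(k+1)=\max_{j\in\mathcal{N}_i}\{x_j(k)\},\qquad i\in\mathcal{V},\ k\in\mathbb{Z}_{\ge 0},$$ converges for all initial conditions $\mathbf{x}(0)\in\mathbb{R}^N$ if and only if the dependency graph $\mathcal{G}(A)$ is strongly connected.
   Context: $\mathbb{T}=\{0,-\infty\}$. An edge $(j,i)\in\mathcal{E}\subset\mathcal{V}\times\mathcal{V}$ is directed from $j$ to $i$ (node $i$ receives information from node $j$), and $\mathcal{N}_i=\{j\in\mathcal{V}:(j,i)\in\mathcal{E}\}$. Self loops: $(i,i)\in\mathcal{E}$ for all $i\in\mathcal{V}$. The tropical adjacency matrix $A$ of $\mathcal{G}$ has $(A)_{i,j}=0$ if $i=j$ or $(j,i)\in\mathcal{E}$, and $(A)_{i,j}=-\infty$ otherwise. The dependency graph $\mathcal{G}(A)$ of a tropical adjacency matrix $A\in\mathbb{T}^{N\times N}$ is the directed graph with node set $\{1,\ldots,N\}$ in which $(i,j)$ is an edge exactly when $(A)_{ji}=0$. A graph with $N$ nodes is strongly connected if for every pair of nodes $i,j$ there is a sequence of nodes $i=i_0,i_1,\ldots,i_s=j$ with $s\le N-1$ and each $(i_{l-1},i_l)$, $l\in\{1,\ldots,s\}$, an edge. The protocol, started at $\mathbf{x}(0)=(x_1(0),\ldots,x_N(0))$,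 converges if there is $n\in\mathbb{N}$ such that for all $k\ge n$ and all $i\in\mathcal{V}$, $x_i(k)=\max_{j\in\mathcal{V}}\{x_j(0)\}$. *)

theory Defs
  imports Complex_Main "HOL-Library.Extended_Real"
begin

text \<open>
  Graphs have node set \<open>{1..N}\<close> and are given by their edge set; an edge \<open>(j, i)\<close> is directed
  from \<open>j\<close> to \<open>i\<close>. Tropical matrices have entries in \<open>ereal\<close>, and node-indexed vectors and
  matrices are functions on \<open>nat\<close> of which only the values at indices in \<open>{1..N}\<close> matter.
\<close>

definition nodes :: "nat \<Rightarrow> nat set" where
  "nodes N = {1..N}"

definition digraph_with_loops :: "nat \<Rightarrow> (nat \<times> nat) set \<Rightarrow> bool" where
  "digraph_with_loops N E \<longleftrightarrow> E \<subseteq> nodes N \<times> nodes N \<and> (\<forall>i\<in>nodes N. (i, i) \<in> E)"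

definition in_neighbours :: "nat \<Rightarrow> (nat \<times> nat) set \<Rightarrow> nat \<Rightarrow> nat set" where
  "in_neighbours N E i = {j \<in> nodes N. (j, i) \<in> E}"

definition tropical_adjacency :: "(nat \<times> nat) set \<Rightarrow> nat \<Rightarrow> nat \<Rightarrow> ereal" where
  "tropical_adjacency E i j = (if i = j \<or> (j, i) \<in> E then 0 else -\<infinity>)"

definition dependency_graph :: "nat \<Rightarrow> (nat \<Rightarrow> nat \<Rightarrow> ereal) \<Rightarrow> (nat \<times> nat) set" where
  "dependency_graph N A = {(i, j). i \<in> nodes N \<and> j \<in> nodes N \<and> A j i = 0}"

definition strongly_connected :: "nat \<Rightarrow> (nat \<times> nat) set \<Rightarrow> bool" where
  "strongly_connected N E \<longleftrightarrow>
     (\<forall>i\<in>nodes N. \<forall>j\<in>nodes N. \<exists>s p. s \<le> N - 1 \<and> p 0 = i \<and> p s = j \<and>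
        (\<forall>l\<le>s. p l \<in> nodes N) \<and> (\<forall>l\<in>{1..s}. (p (l - 1), p l) \<in> E))"

text \<open>
  \<open>max_consensus N E x0 k i\<close> is the state of node \<open>i\<close> at time \<open>k\<close>. With self loops, the maximum
  is over a nonempty finite set at every node.
\<close>

primrec max_consensus ::
    "nat \<Rightarrow> (nat \<times> nat) set \<Rightarrow> (nat \<Rightarrow> real) \<Rightarrow> nat \<Rightarrow> nat \<Rightarrow> real" where
  "max_consensus N E x0 0 = x0"
| "max_consensus N E x0 (Suc k) = (\<lambda>i. Max (max_consensus N E x0 k ` in_neighbours N E i))"

definition consensus_converges :: "nat \<Rightarrow> (nat \<Rightarrow> nat \<Rightarrow> real) \<Rightarrow> bool" where
  "consensus_converges N x \<longleftrightarrow>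
     (\<exists>n. \<forall>k\<ge>n. \<forall>i\<in>nodes N. x k i = Max (x 0 ` nodes N))"

end

theory Submission
  imports Defs
begin

text \<open>
  After \<open>k\<close> steps, node \<open>i\<close> holds the maximum of the initial values over all nodes from which
  there is a walk of length exactly \<open>k\<close> to \<open>i\<close>; because of the self loops, walks can be prolonged
  at will. So under strong connectivity every node sees all initial values after \<open>N - 1\<close> steps.
  Conversely, convergence from the indicator function of a node \<open>j\<close> forces a walk from \<open>j\<close> to
  every node, and a shortest such walk visits no node twice.
\<close>

lemma finite_nodes [simp]: "finite (nodes N)"
  by (simp add: nodes_def)

lemma card_nodes [simp]: "card (nodes N) = N"
  by (simp add: nodes_def)

text \<open>The index swaps in the two definitions cancel, and the zeros on the diagonal match the
  self loops.\<close>

lemma dependency_graph_tropical_adjacency: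
  assumes "digraph_with_loops N E"
  shows "dependency_graph N (tropical_adjacency E) = E"
  using assms
  by (auto simp: dependency_graph_def tropical_adjacency_def digraph_with_loops_def split: if_splits)

text \<open>If \<open>p a = p b\<close> with \<open>a < b\<close>, cutting out the closed segment
  between them leaves a walk from \<open>i\<close> to \<open>j\<close> of length
  \<open>a + (s - b) < s\<close>, against minimality.\<close>

lemma relpow_shortest_inj_on:
  assumes "p 0 = i" and "p s = j" and step: "\<And>l. l < s \<Longrightarrow> (p l, p (Suc l)) \<in> R"
    and least: "\<And>m. (i, j) \<in> R ^^ m \<Longrightarrow> s \<le> m"
  shows "inj_on p {..s}"
proof (rule linorder_inj_onI')
  fix a b assume ab: "a \<in> {..s}" "b \<in> {..s}" "a < b"
  show "p a \<noteq> p b"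
  proof
    assume eq: "p a = p b"
    have "(i, p a) \<in> R ^^ a"
      unfolding relpow_fun_conv using assms ab by (intro exI[of _ p]) auto
    moreover have "(p b, j) \<in> R ^^ (s - b)"
      unfolding relpow_fun_conv using assms ab by (intro exI[of _ "\<lambda>l. p (b + l)"]) auto
    ultimately have "(i, j) \<in> R ^^ (a + (s - b))"
      using eq by (auto simp: relpow_add)
    then show False
      using least[of "a + (s - b)"] ab by auto
  qed
qed

lemma strongly_connected_relpow:
  assumes "strongly_connected N E" "i \<in> nodes N" "j \<in> nodes N"
  shows "\<exists>s\<le>N - 1. (i, j) \<in> E ^^ s"
proof -
  obtain s p where "s \<le> N - 1" "p 0 = i" "p s = j" and step: "\<forall>l\<in>{1..s}. (p (l - 1), p l) \<in> E"
    using assms unfolding strongly_connected_def by blast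
  moreover have "(p l, p (Suc l)) \<in> E" if "l < s" for l
    using bspec[OF step, of "Suc l"] that by simp
  ultimately show ?thesis
    unfolding relpow_fun_conv by blast
qed

text \<open>The length bound \<open>N - 1\<close> comes for free from plain reachability, by passing
  to a walk of least length.\<close>

lemma strongly_connectedI:
  assumes E: "E \<subseteq> nodes N \<times> nodes N"
    and reach: "\<And>i j. i \<in> nodes N \<Longrightarrow> j \<in> nodes N \<Longrightarrow> (i, j) \<in> E\<^sup>*"
  shows "strongly_connected N E"
  unfolding strongly_connected_def
proof (intro ballI)
  fix i j assume ij: "i \<in> nodes N" "j \<in> nodes N"
  define s where "s = (LEAST s. (i, j) \<in> E ^^ s)"
  have "\<exists>s. (i, j) \<in> E ^^ s"
    using reach[OF ij] by (auto simp: rtrancl_is_UN_relpow)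
  then have "(i, j) \<in> E ^^ s"
    unfolding s_def by (rule LeastI_ex)
  then obtain p where p: "p 0 = i" "p s = j" "\<And>l. l < s \<Longrightarrow> (p l, p (Suc l)) \<in> E"
    unfolding relpow_fun_conv by blast
  have in_nodes: "p l \<in> nodes N" if "l \<le> s" for l
  proof (cases "l = s")
    case True
    then show ?thesis using p(2) ij(2) by simp
  next
    case False
    then show ?thesis using p(3)[of l] E that by auto
  qed
  have "inj_on p {..s}"
    by (rule relpow_shortest_inj_on[OF p]) (auto simp: s_def intro: Least_le)
  then have "card {..s} \<le> card (nodes N)"
    by (rule card_inj_on_le) (auto intro: in_nodes)
  \<comment> \<open>\<open>{..s}\<close> has \<open>s + 1\<close> elements, hence
    \<open>s + 1 \<le> N\<close>.\<close>
  then have "s \<le> N - 1" by simp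
  moreover have "(p (l - 1), p l) \<in> E" if "l \<in> {1..s}" for l
    using p(3)[of "l - 1"] that by (cases l) auto
  ultimately show "\<exists>s p. s \<le> N - 1 \<and> p 0 = i \<and> p s = j \<and>
        (\<forall>l\<le>s. p l \<in> nodes N) \<and> (\<forall>l\<in>{1..s}. (p (l - 1), p l) \<in> E)"
    using p in_nodes by blast
qed

text \<open>The walk is prolonged by waiting at its endpoint \<open>j\<close>.\<close>

lemma relpow_loop_mono:
  assumes "(i, j) \<in> R ^^ s" "(j, j) \<in> R" "s \<le> k"
  shows "(i, j) \<in> R ^^ k"
  using assms(3,1) by (induction rule: dec_induct) (use assms(2) in auto)

text \<open>A nonempty walk leaves \<open>j\<close> along an edge of \<open>E\<close>; for
  \<open>k = 0\<close> the source is \<open>i\<close> itself.\<close>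

lemma relpow_source_in_nodes:
  assumes "E \<subseteq> nodes N \<times> nodes N" "i \<in> nodes N" "(j, i) \<in> E ^^ k"
  shows "j \<in> nodes N"
  using assms by (cases k) (auto simp del: relpow.simps(2) dest!: relpow_Suc_D2)

text \<open>Merges the nested maxima that arise when one protocol step is applied to a state that is
  already a maximum.\<close>

lemma Max_UN:
  fixes f :: "'a \<Rightarrow> 'b :: linorder set"
  assumes "finite I" "I \<noteq> {}" "\<And>i. i \<in> I \<Longrightarrow> finite (f i)" "\<And>i. i \<in> I \<Longrightarrow> f i \<noteq> {}"
  shows "Max (\<Union>i\<in>I. f i) = Max ((\<lambda>i. Max (f i)) ` I)"
proof (rule Max_eqI)
  show "finite (\<Union>i\<in>I. f i)"
    using assms by auto
  have "Max ((\<lambda>i. Max (f i)) ` I) \<in> (\<lambda>i. Max (f i)) ` I"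
    using assms by (intro Max_in) auto
  then show "Max ((\<lambda>i. Max (f i)) ` I) \<in> (\<Union>i\<in>I. f i)"
    using assms(3,4) Max_in by fastforce
next
  fix y assume "y \<in> (\<Union>i\<in>I. f i)"
  then obtain i where i: "i \<in> I" "y \<in> f i" by blast
  then have "y \<le> Max (f i)"
    using assms(3) by simp
  also have "\<dots> \<le> Max ((\<lambda>i. Max (f i)) ` I)"
    using assms(1) i by simp
  finally show "y \<le> Max ((\<lambda>i. Max (f i)) ` I)" .
qed

lemma max_consensus_eq_Max_walks:
  assumes "digraph_with_loops N E" "i \<in> nodes N"
  shows "max_consensus N E x0 k i = Max (x0 ` {j. (j, i) \<in> E ^^ k})"
  using assms(2)
proof (induction k arbitrary: i)
  case 0
  then show ?case by simp
next
  case (Suc k)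
  let ?S = "\<lambda>i. {j. (j, i) \<in> E ^^ k}"
  have E: "E \<subseteq> nodes N \<times> nodes N" and loops: "\<And>j. j \<in> nodes N \<Longrightarrow> (j, j) \<in> E"
    using assms(1) by (auto simp: digraph_with_loops_def)
  have fin: "finite (?S j)" if "j \<in> nodes N" for j
    using relpow_source_in_nodes[OF E that] by (intro finite_subset[OF _ finite_nodes]) auto
  \<comment> \<open>Circling \<open>k\<close> times in the loop at \<open>j\<close> shows that
    \<open>j\<close> is a member.\<close>
  have ne: "?S j \<noteq> {}" if "j \<in> nodes N" for j
    using relpow_loop_mono[of j j 0 E k] loops[OF that] by auto
  have nbrs: "finite (in_neighbours N E i)" "in_neighbours N E i \<noteq> {}"
    "in_neighbours N E i \<subseteq> nodes N"
    using Suc.prems loops by (auto simp: in_neighbours_def)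
  have "max_consensus N E x0 (Suc k) i = Max ((\<lambda>j. Max (x0 ` ?S j)) ` in_neighbours N E i)"
    using Suc.IH nbrs(3) by (auto intro!: arg_cong[where f = Max] image_cong)
  also have "\<dots> = Max (\<Union>j\<in>in_neighbours N E i. x0 ` ?S j)"
    using fin ne nbrs by (intro Max_UN[symmetric]) auto
  \<comment> \<open>Splitting off the last edge of a walk of length \<open>Suc k\<close> to
    \<open>i\<close> leaves a walk of length \<open>k\<close> to an in-neighbour of
    \<open>i\<close>.\<close>
  also have "(\<Union>j\<in>in_neighbours N E i. x0 ` ?S j) = x0 ` {j. (j, i) \<in> E ^^ Suc k}"
    using E by (auto simp: in_neighbours_def)
  finally show ?case .
qed

lemma consensus_converges_if_strongly_connected:
  assumes G: "digraph_with_loops N E" and "strongly_connected N E"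
  shows "consensus_converges N (max_consensus N E x0)"
  unfolding consensus_converges_def
\<comment> \<open>Every pair of nodes is joined by a walk of length at most \<open>N - 1\<close>, so
  this time works for every \<open>x0\<close>.\<close>
proof (intro exI[of _ "N - 1"] allI impI ballI)
  fix k i assume k: "N - 1 \<le> k" and i: "i \<in> nodes N"
  have E: "E \<subseteq> nodes N \<times> nodes N" and "(i, i) \<in> E"
    using G i by (auto simp: digraph_with_loops_def)
  have "(j, i) \<in> E ^^ k" if "j \<in> nodes N" for j
    using strongly_connected_relpow[OF assms(2) that i] k
    by (auto intro: relpow_loop_mono[OF _ \<open>(i, i) \<in> E\<close>])
  then have "{j. (j, i) \<in> E ^^ k} = nodes N"
    using relpow_source_in_nodes[OF E i] by auto
  then show "max_consensus N E x0 k i = Max (max_consensus N E x0 0 ` nodes N)"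
    by (simp add: max_consensus_eq_Max_walks[OF G i])
qed

lemma reachable_if_consensus_converges:
  assumes G: "digraph_with_loops N E" and ij: "i \<in> nodes N" "j \<in> nodes N"
    and conv: "consensus_converges N (max_consensus N E (\<lambda>l. of_bool (l = i)))"
  shows "(i, j) \<in> E\<^sup>*"
proof -
  let ?x = "(\<lambda>l. of_bool (l = i)) :: nat \<Rightarrow> real"
  obtain n where "max_consensus N E ?x n j = Max (?x ` nodes N)"
    using conv ij by (auto simp: consensus_converges_def)
  then have eq: "Max (?x ` {l. (l, j) \<in> E ^^ n}) = Max (?x ` nodes N)"
    using max_consensus_eq_Max_walks[OF G ij(2)] by simp
  have E: "E \<subseteq> nodes N \<times> nodes N" "(j, j) \<in> E"
    using G ij by (auto simp: digraph_with_loops_def)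
  have "finite {l. (l, j) \<in> E ^^ n}"
    using relpow_source_in_nodes[OF E(1) ij(2)] by (intro finite_subset[OF _ finite_nodes]) auto
  moreover have "{l. (l, j) \<in> E ^^ n} \<noteq> {}"
    using relpow_loop_mono[of j j 0 E n] E(2) by auto
  \<comment> \<open>The maximum is attained at the source of some walk to \<open>j\<close>. Since it
    equals the global maximum, which is at least \<open>?x i = 1\<close>, and \<open>?x\<close> is 0
    away from \<open>i\<close>, that source must be \<open>i\<close>.\<close>
  ultimately have "Max (?x ` {l. (l, j) \<in> E ^^ n}) \<in> ?x ` {l. (l, j) \<in> E ^^ n}"
    by (intro Max_in) auto
  then obtain l where l: "(l, j) \<in> E ^^ n" "Max (?x ` nodes N) = ?x l"
    using eq by auto
  have "?x i \<le> Max (?x ` nodes N)"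
    using ij by (intro Max_ge) auto
  then have "l = i"
    using l(2) by (cases "l = i") simp_all
  then show ?thesis
    using l(1) relpow_imp_rtrancl by blast
qed

theorem theorem4p12:
  fixes N :: nat and E :: "(nat \<times> nat) set" and A :: "nat \<Rightarrow> nat \<Rightarrow> ereal"
  assumes "N \<ge> 1"
    and "digraph_with_loops N E"
    and "A = tropical_adjacency E"
  shows "(\<forall>x0 :: nat \<Rightarrow> real. consensus_converges N (max_consensus N E x0)) \<longleftrightarrow>
         strongly_connected N (dependency_graph N A)"
proof -
  have dep: "dependency_graph N A = E"
    using assms(2,3) by (simp add: dependency_graph_tropical_adjacency)
  have E: "E \<subseteq> nodes N \<times> nodes N"
    using assms(2) by (simp add: digraph_with_loops_def)
  show ?thesis
    unfolding dep
  proof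
    assume "\<forall>x0. consensus_converges N (max_consensus N E x0)"
    then show "strongly_connected N E"
      by (intro strongly_connectedI[OF E] reachable_if_consensus_converges[OF assms(2)]) auto
  next
    assume "strongly_connected N E"
    then show "\<forall>x0. consensus_converges N (max_consensus N E x0)"
      using consensus_converges_if_strongly_connected[OF assms(2)] by blast
  qed
qed

end
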